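(* For every odd prime number $p$, there exist exactly $(p+1)/2$ ordered quadruplets $(a,b,c,d)\in\mathbb N^4$ such that $p=a\cdot b+c\cdot d$ and $\min(a,b)>\max(c,d)$.
   Context: $\mathbb N=\{0,1,2,\ldots\}$ includes $0$. *)

theory Defs
  imports "HOL-Computational_Algebra.Primes"
begin

end

theory Submission imports Defs begin

text \<open>
  A solution \<open>(a, b, c, d)\<close> is read as the pair of vectors \<open>(a, c)\<close> and \<open>(- d, b)\<close> of the
  integer plane. Their determinant is \<open>a * b + c * d = p\<close>, so they span a sublattice of index
  \<open>p\<close>, and the inequalities say that they form a basis that is reduced in a certain sense. The
  sublattices of prime index \<open>p\<close> are the \<open>p + 1\<close> lattices
  \<open>{(x, y). x \<equiv> k * y (mod p)}\<close>, with \<open>k\<close> in the projective line over the field with \<open>p\<close>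
  elements, and reflection in a coordinate axis exchanges \<open>k\<close> and \<open>- k\<close>.

  The two lattices fixed by this reflection, \<open>k = 0\<close> and \<open>k = \<infinity>\<close>, carry the two degenerate
  solutions \<open>p = p * 1 + 0 * 0\<close> and \<open>p = 1 * p + 0 * 0\<close>; a solution with \<open>c = 0\<close> or \<open>d = 0\<close>
  gives a factorisation \<open>p = a * b\<close>, so there are no others. The lattices \<open>k = \<plusminus> 1\<close> carry no
  solution, because \<open>a \<equiv> \<plusminus> c\<close> is impossible for \<open>0 < c < a\<close> with \<open>a + c < p\<close>. From every
  other pair \<open>{k, - k}\<close> exactly one of the two lattices has a reduced basis, and this basis is
  unique. Such pairs are represented by \<open>2 \<le> k \<le> (p - 1) / 2\<close>, which gives \<open>(p - 3) / 2\<close>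
  solutions with \<open>c, d > 0\<close>, and \<open>(p + 1) / 2\<close> in all.

  Existence (\<open>reduced_basis_exists\<close>) comes from the Euclidean algorithm on \<open>p\<close> and \<open>k\<close>: the
  remainders decrease, the cofactors increase, and a reduced basis appears when they cross.
  Uniqueness (\<open>reduced_basis_unique\<close>, \<open>no_reduced_basis_of_reflection\<close>) comes from the
  integer matrix of determinant 1 that changes one basis into another: the inequalities control
  the signs of its entries and leave only the identity.
\<close>

section \<open>Lattices of prime index and reduced bases\<close>

text \<open>
  With \<open>c\<close> and \<open>d\<close> positive, the vectors \<open>(a, c)\<close> and \<open>(- d, b)\<close> lie in the open cones
  \<open>0 < y < x\<close> and \<open>0 < - x < y\<close>; the conditions \<open>d < a\<close> and \<open>c < b\<close> compare the two vectors
  with each other.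
\<close>
definition reduced :: "int \<Rightarrow> int \<Rightarrow> int \<Rightarrow> int \<Rightarrow> int \<Rightarrow> bool" where
  "reduced p a b c d \<longleftrightarrow> p = a * b + c * d \<and> 0 < c \<and> 0 < d \<and> c < a \<and> d < a \<and> c < b \<and> d < b"

text \<open>
  The lattice with parameter \<open>k\<close> is \<open>{(x, y). x \<equiv> k * y (mod p)}\<close>.
\<close>
definition in_lattice :: "int \<Rightarrow> int \<Rightarrow> int \<Rightarrow> int \<Rightarrow> bool" where
  "in_lattice p k x y \<longleftrightarrow> p dvd x - k * y"

text \<open>
  Both vectors are determined modulo \<open>p\<close> by their second coordinates, as multiples of the
  single vector \<open>(k, 1)\<close>; hence they are linearly dependent modulo \<open>p\<close>.
\<close>
lemma in_lattice_det:
  assumes "in_lattice p k x y" "in_lattice p k x' y'"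
  shows "p dvd x * y' - x' * y"
proof -
  have "x * y' - x' * y = (x - k * y) * y' - (x' - k * y') * y"
    by (simp add: algebra_simps)
  then show ?thesis
    using assms unfolding in_lattice_def by (metis dvd_diff dvd_mult2)
qed

lemma in_lattice_reflect:
  "in_lattice p (- k) x y \<longleftrightarrow> in_lattice p k x (- y)"
  "in_lattice p (- k) x y \<longleftrightarrow> in_lattice p k (- x) y"
proof -
  show "in_lattice p (- k) x y \<longleftrightarrow> in_lattice p k x (- y)"
    by (simp add: in_lattice_def)
  have "- x - k * y = - (x - (- k) * y)" by simp
  then show "in_lattice p (- k) x y \<longleftrightarrow> in_lattice p k (- x) y"
    unfolding in_lattice_def by (simp only: dvd_minus_iff)
qed

text \<open>
  Modulo \<open>p\<close> the equation reads \<open>a * b \<equiv> - c * d\<close>; substituting \<open>a \<equiv> k * c\<close> and cancelling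
  \<open>c\<close> gives \<open>- d \<equiv> k * b\<close>. So the first basis vector alone decides to which lattice a
  solution belongs.
\<close>
lemma second_basis_vector_in_lattice:
  assumes "prime p" and "p = a * b + c * d" and "0 < c" "c < p"
    and "in_lattice p k a c"
  shows "in_lattice p k (- d) b"
proof -
  have "\<not> p dvd c" using assms(3,4) zdvd_not_zless by blast
  moreover have "c * (- d - k * b) = b * (a - k * c) - p"
    using assms(2) by (simp add: algebra_simps)
  then have "p dvd c * (- d - k * b)"
    using assms(5) unfolding in_lattice_def by simp
  ultimately show ?thesis
    using assms(1) unfolding in_lattice_def by (simp add: prime_dvd_mult_iff)
qed

section \<open>Uniqueness\<close>

text \<open>
  This is Cramer's rule for expressing the primed basis by the unprimed one. The coefficients
  are determinants of lattice vectors divided by \<open>p\<close>, hence integers; writing them as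
  determinants makes their signs visible when the bases are reduced. Both bases have determinant
  \<open>p\<close>, so the matrix of coefficients has determinant 1.
\<close>
lemma base_change:
  fixes a b c d a' b' c' d' :: int
  assumes p: "p = a * b + c * d" "p = a' * b' + c' * d'" "p > 0"
    and L: "in_lattice p k a c" "in_lattice p k (- d) b"
    and L': "in_lattice p k a' c'" "in_lattice p k (- d') b'"
  obtains m n m' n' where
    "a' * b + c' * d = p * m" "a * c' - a' * c = p * n"
    "a * b' + c * d' = p * m'" "d * b' - d' * b = p * n'"
    "a' = m * a - n * d" "c' = m * c + n * b"
    "d' = m' * d - n' * a" "b' = m' * b + n' * c"
    "m * m' - n * n' = 1"
proof -
  have "p dvd a' * b + c' * d" "p dvd a * c' - a' * c" "p dvd a * b' + c * d'" "p dvd d * b' - d' * b"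
    using in_lattice_det[OF L'(1) L(2)] in_lattice_det[OF L(1) L'(1)]
      in_lattice_det[OF L(1) L'(2)] in_lattice_det[OF L'(2) L(2)]
    by (simp_all add: mult.commute)
  then obtain m n m' n' where e:
    "a' * b + c' * d = p * m" "a * c' - a' * c = p * n"
    "a * b' + c * d' = p * m'" "d * b' - d' * b = p * n'"
    by (elim dvdE)
  have "p * a' = p * (m * a - n * d)" using e(1,2) p(1) by algebra
  then have 1: "a' = m * a - n * d" using p(3) by simp
  have "p * c' = p * (m * c + n * b)" using e(1,2) p(1) by algebra
  then have 2: "c' = m * c + n * b" using p(3) by simp
  have "p * d' = p * (m' * d - n' * a)" using e(3,4) p(1) by algebra
  then have 3: "d' = m' * d - n' * a" using p(3) by simp
  have "p * b' = p * (m' * b + n' * c)" using e(3,4) p(1) by algebra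
  then have 4: "b' = m' * b + n' * c" using p(3) by simp
  have "p = a' * b' + c' * d'" by (rule p(2))
  also have "\<dots> = (m * m' - n * n') * (a * b + c * d)"
    unfolding 1 2 3 4 by algebra
  also have "\<dots> = (m * m' - n * n') * p" using p(1) by simp
  finally have 5: "m * m' - n * n' = 1" using p(3) by simp
  show ?thesis by (rule that[OF e 1 2 3 4 5])
qed

text \<open>
  If \<open>(a', c')\<close> were steeper than \<open>(a, c)\<close>, then \<open>m, m', n > 0\<close> in the base change, and the
  determinant forces \<open>n' \<ge> 0\<close>. For \<open>n' = 0\<close> the new first vector has a second coordinate
  \<open>c' \<ge> b = b'\<close>, which is too large. For \<open>n' > 0\<close> the inequalities \<open>c' < a'\<close> and \<open>0 < d'\<close>
  bound \<open>m / n\<close> and \<open>m' / n'\<close> from below so strongly that \<open>m * m' - n * n'\<close> exceeds 1.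
\<close>
lemma reduced_basis_slope_le:
  assumes r: "reduced p a b c d" "reduced p a' b' c' d'"
    and L: "in_lattice p k a c" "in_lattice p k (- d) b"
    and L': "in_lattice p k a' c'" "in_lattice p k (- d') b'"
  shows "a * c' \<le> a' * c"
proof (rule ccontr)
  assume contra: "\<not> ?thesis"
  note r = r[unfolded reduced_def]
  have p: "p = a * b + c * d" "p = a' * b' + c' * d'" using r by auto
  have p0: "p > 0" using r by (auto intro: add_pos_pos)
  obtain m n m' n' where e:
    "a' * b + c' * d = p * m" "a * c' - a' * c = p * n"
    "a * b' + c * d' = p * m'" "d * b' - d' * b = p * n'"
    "a' = m * a - n * d" "c' = m * c + n * b"
    "d' = m' * d - n' * a" "b' = m' * b + n' * c"
    "m * m' - n * n' = 1"
    by (rule base_change[OF p p0 L L'])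
  have "p * m > 0" unfolding e(1)[symmetric] using r by (auto intro: add_pos_pos)
  then have m: "m > 0" using p0 by (simp add: zero_less_mult_iff)
  have "p * m' > 0" unfolding e(3)[symmetric] using r by (auto intro: add_pos_pos)
  then have m': "m' > 0" using p0 by (simp add: zero_less_mult_iff)
  have "p * n > 0" unfolding e(2)[symmetric] using contra by simp
  then have n: "n > 0" using p0 by (simp add: zero_less_mult_iff)
  have "m * m' > 0" using m m' by simp
  then have "n * n' \<ge> 0" using e(9) by linarith
  then have "n' \<ge> 0" using n by (simp add: zero_le_mult_iff)
  then consider "n' = 0" | "n' > 0" by linarith
  then show False
  proof cases
    case 1
    then have mm: "m = 1" "m' = 1" using e(9) m m' by (auto simp: zmult_eq_1_iff)
    have "n * b \<ge> 1 * b" using n r by (intro mult_right_mono) auto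
    moreover have "c' = c + n * b" "b' = b" using e(6,8) 1 mm by simp_all
    ultimately show False using r by linarith
  next
    case 2
    have "m * c > 0" using m r by simp
    then have "n * (b + d) < m * a" using e(5,6) r by (simp add: algebra_simps)
    then have "n' * (n * (b + d)) < n' * (m * a)" using 2 by simp
    also have "\<dots> = m * (n' * a)" by simp
    also have "\<dots> < m * (m' * d)" using e(7) r m by simp
    also have "\<dots> = (1 + n * n') * d" using e(9) by (simp add: algebra_simps)
    finally have "(n * n') * b < d" by (simp add: algebra_simps)
    moreover have "n * n' \<ge> 1" using n 2 by (simp add: int_one_le_iff_zero_less)
    then have "(n * n') * b \<ge> 1 * b" using r by (intro mult_right_mono) auto
    ultimately show False using r by simp
  qed
qed

text \<open>
  By symmetry both first vectors have the same slope, so they agree. The second vectors then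
  differ by a multiple of the first one, and since both \<open>d\<close> and \<open>d'\<close> lie strictly between \<open>0\<close>
  and \<open>a\<close>, this multiple is zero.
\<close>
lemma reduced_basis_unique:
  assumes r: "reduced p a b c d" "reduced p a' b' c' d'"
    and L: "in_lattice p k a c" "in_lattice p k (- d) b"
    and L': "in_lattice p k a' c'" "in_lattice p k (- d') b'"
  shows "a' = a \<and> b' = b \<and> c' = c \<and> d' = d"
proof -
  have eq: "a * c' - a' * c = 0"
    using reduced_basis_slope_le[OF r L L'] reduced_basis_slope_le[OF r(2,1) L' L] by simp
  note r = r[unfolded reduced_def]
  have p: "p = a * b + c * d" "p = a' * b' + c' * d'" using r by auto
  have p0: "p > 0" using r by (auto intro: add_pos_pos)
  obtain m n m' n' where e:
    "a' * b + c' * d = p * m" "a * c' - a' * c = p * n"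
    "a * b' + c * d' = p * m'" "d * b' - d' * b = p * n'"
    "a' = m * a - n * d" "c' = m * c + n * b"
    "d' = m' * d - n' * a" "b' = m' * b + n' * c"
    "m * m' - n * n' = 1"
    by (rule base_change[OF p p0 L L'])
  have n: "n = 0" using eq e(2) p0 by simp
  have "p * m > 0" unfolding e(1)[symmetric] using r by (auto intro: add_pos_pos)
  then have "m > 0" using p0 by (simp add: zero_less_mult_iff)
  then have m: "m = 1" "m' = 1" using e(9) n by (auto simp: zmult_eq_1_iff)
  have a: "a' = a" and c: "c' = c" using e m n by auto
  have d: "d' = d - n' * a" using e m by simp
  have "n' = 0"
  proof (rule ccontr)
    assume "n' \<noteq> 0"
    then consider "n' \<ge> 1" | "- n' \<ge> 1" by linarith
    then show False
    proof cases
      case 1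
      then have "n' * a \<ge> 1 * a" using r by (intro mult_right_mono) auto
      then show False using d r by (smt (verit))
    next
      case 2
      then have "(- n') * a \<ge> 1 * a" using r by (intro mult_right_mono) auto
      then show False using d r a by (smt (verit) mult_minus_left)
    qed
  qed
  then show ?thesis using e m a c by simp
qed

text \<open>
  Reflecting the second basis puts it into the same lattice as the first one, with vectors
  \<open>(a', - c')\<close> and \<open>(d', b')\<close>. Now every coefficient of the base change has a forced sign:
  \<open>m, m', n' > 0 > n\<close>, so that \<open>m * m' - n * n' \<ge> 2\<close> instead of 1.
\<close>
lemma no_reduced_basis_of_reflection:
  assumes r: "reduced p a b c d" "reduced p a' b' c' d'"
    and L: "in_lattice p k a c" "in_lattice p k (- d) b"
    and L': "in_lattice p (- k) a' c'" "in_lattice p (- k) (- d') b'"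
  shows False
proof -
  note r = r[unfolded reduced_def]
  have p: "p = a * b + c * d" "p = a' * b' + (- c') * (- d')" using r by auto
  have p0: "p > 0" using r by (auto intro: add_pos_pos)
  \<comment> \<open>the base change is applied with \<open>- c'\<close> and \<open>- d'\<close> in place of \<open>c'\<close> and \<open>d'\<close>\<close>
  have L'': "in_lattice p k a' (- c')" "in_lattice p k (- (- d')) b'"
    using L' in_lattice_reflect by blast+
  obtain m n m' n' where e:
    "a' * b + (- c') * d = p * m" "a * (- c') - a' * c = p * n"
    "a * b' + c * (- d') = p * m'" "d * b' - (- d') * b = p * n'"
    "m * m' - n * n' = 1"
    by (rule base_change[OF p p0 L L''])
  have "c' * d < a' * b" using r by (intro mult_strict_mono) auto
  then have "p * m > 0" unfolding e(1)[symmetric] by simp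
  then have m: "m \<ge> 1" using p0 by (simp add: zero_less_mult_iff)
  have "c * d' < a * b'" using r by (intro mult_strict_mono) auto
  then have "p * m' > 0" unfolding e(3)[symmetric] by simp
  then have m': "m' \<ge> 1" using p0 by (simp add: zero_less_mult_iff)
  have "a * c' + a' * c > 0" using r by (auto intro: add_pos_pos)
  then have "p * (- n) > 0" using e(2) by simp
  then have n: "- n \<ge> 1" using p0 by (simp add: mult_less_0_iff)
  have "p * n' > 0" unfolding e(4)[symmetric] using r by (auto intro: add_pos_pos)
  then have n': "n' \<ge> 1" using p0 by (simp add: zero_less_mult_iff)
  have "m * m' > 0" using m m' by simp
  moreover have "n * n' < 0" using n n' by (intro mult_neg_pos) auto
  ultimately show False using e(5) by simp
qed

section \<open>Existence\<close>

text \<open>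
  The Euclidean algorithm on consecutive remainders \<open>a > d\<close>, where \<open>c < b\<close> are the
  absolute values of the cofactors. Their signs alternate, which appears here as the exchange of \<open>k\<close> and \<open>- k\<close>, and the
  relation \<open>p = a * b + c * d\<close> is the usual invariant of the cofactors. One step passes from
  \<open>(a, b, c, d)\<close> to \<open>(d, c + q * b, b, a - q * d)\<close> with \<open>q = a div d\<close>. It is made as long as
  \<open>b < d\<close>, which keeps \<open>c < a\<close>. Once \<open>d < b\<close> the basis is reduced; \<open>c = 0\<close>
  is impossible then, because \<open>b\<close> would divide \<open>p\<close>. The case \<open>b = d\<close> would
  make \<open>d\<close> a divisor of \<open>p\<close>, hence \<open>b = d = 1\<close> and \<open>k \<equiv> - 1\<close>, which the bounds on \<open>k\<close>
  exclude. The premise for \<open>c = 0\<close> concerns the initial state: it yields \<open>q \<ge> 2\<close> there, without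
  which the new cofactor \<open>q * b\<close> would not exceed \<open>b\<close>.
\<close>
lemma euclid_reaches_reduced_basis:
  fixes a b c d k p :: int
  assumes "prime p" "1 < \<bar>k\<bar>" "\<bar>k\<bar> < p - 1"
    and "p = a * b + c * d" "0 < d" "d < a" "0 \<le> c" "c < b" "c < a"
    and "c = 0 \<Longrightarrow> 2 * d \<le> a"
    and "in_lattice p k a c" "in_lattice p k (- d) b"
  shows "\<exists>a b c d. reduced p a b c d \<and>
    (in_lattice p k a c \<or> in_lattice p (- k) a c)"
  using assms
proof (induction "nat d" arbitrary: a b c d k rule: less_induct)
  case less
  note prem = less.prems
  have dvd: "d = 1" if "d dvd a * b"
  proof -
    have "d dvd p" using that prem(4) by simp
    then have "d = 1 \<or> d = p" using prem(1,5) by (auto simp: prime_int_iff)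
    moreover have "d < p"
    proof -
      have "a * 1 \<le> a * b" using prem by (intro mult_left_mono) auto
      then show ?thesis using prem by (smt (verit) mult_nonneg_nonneg)
    qed
    ultimately show ?thesis by simp
  qed
  consider "d < b" | "d = b" | "b < d" by linarith
  then show ?case
  proof cases
    case 1
    have "c \<noteq> 0"
    proof
      assume "c = 0"
      then have "b dvd p" using prem(4) by simp
      then have "b = p" using prem(1) 1 prem(5) unfolding prime_int_iff by (smt (verit))
      then have "a = 1" using \<open>c = 0\<close> prem 1 by auto
      then show False using prem by simp
    qed
    then show ?thesis using prem 1 unfolding reduced_def
      by (intro exI[of _ a] exI[of _ b] exI[of _ c] exI[of _ d]) auto
  next
    case 2
    then have "d = 1" "b = 1" using dvd by auto
    have "- d - k * b = - (k + 1)" using \<open>d = 1\<close> \<open>b = 1\<close> by simp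
    then have "p dvd k + 1" using prem(12) unfolding in_lattice_def by (simp only: dvd_minus_iff)
    then have "\<bar>p\<bar> \<le> \<bar>k + 1\<bar>" using prem(2) by (intro dvd_imp_le_int) auto
    then show ?thesis using prem(3) by linarith
  next
    case 3
    define q where "q = a div d"
    define a1 where "a1 = a mod d"
    have a: "a = q * d + a1" unfolding q_def a1_def by simp
    have q: "q \<ge> 1" unfolding q_def using prem pos_imp_zdiv_pos_iff[of d a] by simp
    have a1: "0 \<le> a1" "a1 < d" unfolding a1_def using prem by auto
    have "a1 \<noteq> 0"
    proof
      assume "a1 = 0"
      then have "d = 1" using dvd a by simp
      then show False using 3 prem by simp
    qed
    have b1: "b < c + q * b"
    proof (cases "c = 0")
      case True
      then have "q \<ge> 2" unfolding q_def using prem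
        by (metis div_by_0 nonzero_mult_div_cancel_right order_less_irrefl zdiv_mono1)
      then have "2 * b \<le> q * b" using prem by (intro mult_right_mono) auto
      then show ?thesis using True prem(7,8) by linarith
    next
      case False
      have "1 * b \<le> q * b" using prem q by (intro mult_right_mono) auto
      then show ?thesis using False prem(7) by linarith
    qed
    have "\<exists>a b c d. reduced p a b c d \<and>
      (in_lattice p (- k) a c \<or> in_lattice p (- (- k)) a c)"
    proof (rule less.hyps[of a1 "- k" d "c + q * b" b])
      show "p = d * (c + q * b) + b * a1" using prem(4) a by (simp add: algebra_simps)
      show d: "in_lattice p (- k) d b" using prem(12) in_lattice_reflect(2) by blast
      have "- a1 - (- k) * (c + q * b) = - (a - k * c) + q * (d - (- k) * b)"
        using a by (simp add: algebra_simps)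
      then show "in_lattice p (- k) (- a1) (c + q * b)"
        using prem(11) d unfolding in_lattice_def by (metis dvd_add dvd_minus_iff dvd_mult)
    qed (use prem 3 a1 \<open>a1 \<noteq> 0\<close> b1 in auto)
    then show ?thesis by auto
  qed
qed

text \<open>
  The algorithm starts with remainders \<open>p, k\<close> and cofactors \<open>0, 1\<close>; the vector \<open>(- k, 1)\<close>
  lies in the lattice of \<open>- k\<close>, whence the sign in the proof.
\<close>
lemma reduced_basis_exists:
  fixes p k :: int
  assumes "prime p" "1 < k" "2 * k < p"
  shows "\<exists>a b c d. reduced p a b c d \<and>
    (in_lattice p k a c \<or> in_lattice p (- k) a c)"
proof -
  have "in_lattice p (- k) p 0" "in_lattice p (- k) (- k) 1" by (auto simp: in_lattice_def)
  then show ?thesis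
    using euclid_reaches_reduced_basis[of p "- k" p 1 0 k] assms by auto
qed

section \<open>Counting\<close>

text \<open>
  Invert \<open>c\<close> modulo \<open>p\<close> to solve \<open>a \<equiv> j * c\<close>, and choose \<open>k\<close> as the smaller one of \<open>j\<close> and
  \<open>p - j\<close>. Here \<open>k = 1\<close> would make \<open>p\<close> divide \<open>a - c\<close> or \<open>a + c\<close>, which are positive and
  less than \<open>p\<close> because \<open>b \<ge> 2\<close> gives \<open>p > 2 * a\<close>.
\<close>
lemma lattice_index_exists:
  assumes "prime p" and r: "reduced p a b c d"
  shows "\<exists>k. 1 < k \<and> 2 * k \<le> p \<and> (in_lattice p k a c \<or> in_lattice p (- k) a c)"
proof -
  note r = r[unfolded reduced_def]
  have "a * 2 \<le> a * b" "0 < c * d" using r by (auto intro!: mult_left_mono)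
  then have ac: "a + c < p" using r by linarith
  have "\<not> p dvd c" using ac r by (auto dest: zdvd_imp_le)
  then have "coprime c p" using prime_imp_coprime[OF \<open>prime p\<close>] coprime_commute by blast
  then obtain u v where uv: "u * c + v * p = 1" by (metis bezout_int coprime_imp_gcd_eq_1)
  \<comment> \<open>\<open>u\<close> is the inverse of \<open>c\<close> modulo \<open>p\<close>\<close>
  define j where "j = (u * a) mod p"
  have p0: "p > 0" using ac r by simp
  have j: "0 \<le> j" "j < p" unfolding j_def using p0 by auto
  have "a - j * c = a - u * a * c + ((u * a) div p * p) * c"
    unfolding j_def by (simp add: minus_div_mult_eq_mod[symmetric] algebra_simps)
  also have "\<dots> = a * (u * c + v * p) - u * a * c + ((u * a) div p * p) * c"
    unfolding uv by simp
  also have "\<dots> = p * (a * v + (u * a) div p * c)" by (simp add: algebra_simps)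
  finally have L: "p dvd a - j * c" by simp
  have "\<not> p dvd a" "\<not> p dvd a - c" "\<not> p dvd a + c"
    using ac r by (auto dest: zdvd_imp_le)
  have L2: "p dvd a - (- (p - j)) * c"
  proof -
    have "a - (- (p - j)) * c = (a - j * c) + p * c" by (simp add: algebra_simps)
    then show ?thesis by (simp only: L dvd_add dvd_triv_left)
  qed
  have "j \<noteq> 0" using L \<open>\<not> p dvd a\<close> by auto
  moreover have "j \<noteq> 1" using L \<open>\<not> p dvd a - c\<close> by auto
  moreover have "p - j \<noteq> 1"
  proof
    assume *: "p - j = 1"
    show False using L2 \<open>\<not> p dvd a + c\<close> unfolding * by simp
  qed
  ultimately have "1 < j \<and> 2 * j \<le> p \<or> 1 < p - j \<and> 2 * (p - j) \<le> p" using j by presburger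
  then show ?thesis using L L2 unfolding in_lattice_def by blast
qed

lemma lattice_index_unique:
  fixes p k l :: int
  assumes "prime p" "0 < c" "c < p" and "0 < k" "2 * k < p" "0 < l" "2 * l < p"
    and "in_lattice p k a c \<or> in_lattice p (- k) a c"
    and "in_lattice p l a c \<or> in_lattice p (- l) a c"
  shows "k = l"
proof -
  have *: "p dvd x - y" if "in_lattice p x a c" "in_lattice p y a c" for x y
  proof -
    have "(x - y) * c = (a - y * c) - (a - x * c)" by (simp add: algebra_simps)
    then have "p dvd (x - y) * c" using that unfolding in_lattice_def by (metis dvd_diff)
    moreover have "\<not> p dvd c" using assms(2,3) zdvd_not_zless by blast
    ultimately show ?thesis using assms(1) by (simp add: prime_dvd_mult_iff)
  qed
  have **: "z = 0" if "p dvd z" "\<bar>z\<bar> < p" for z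
    using that dvd_imp_le_int[of z p] by fastforce
  consider "p dvd k - l" | "p dvd k + l" | "p dvd - k - l" | "p dvd - k + l"
    using assms(8,9) *[of k l] *[of k "- l"] *[of "- k" l] *[of "- k" "- l"] by auto
  then show ?thesis by cases (use ** assms(4-7) in force)+
qed

definition in_lattice_up_to_reflection :: "nat \<Rightarrow> nat \<Rightarrow> nat \<times> nat \<times> nat \<times> nat \<Rightarrow> bool" where
  "in_lattice_up_to_reflection p k = (\<lambda>(a, b, c, d).
     in_lattice (int p) (int k) (int a) (int c) \<or> in_lattice (int p) (- int k) (int a) (int c))"

lemma card_eq_of_unique_correspondence:
  assumes "\<And>x. x \<in> A \<Longrightarrow> \<exists>!y. y \<in> B \<and> R x y"
    and "\<And>y. y \<in> B \<Longrightarrow> \<exists>!x. x \<in> A \<and> R x y"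
  shows "card A = card B"
proof (rule bij_betw_same_card)
  let ?f = "\<lambda>x. THE y. y \<in> B \<and> R x y"
  have f: "?f x \<in> B \<and> R x (?f x)" if "x \<in> A" for x
    using theI'[OF assms(1)[OF that]] .
  show "bij_betw ?f A B"
  proof (rule bij_betwI')
    fix x x' assume "x \<in> A" "x' \<in> A"
    then show "?f x = ?f x' \<longleftrightarrow> x = x'" using assms(2) f by metis
  next
    fix y assume "y \<in> B"
    then obtain x where "x \<in> A" "R x y" using assms(2) by blast
    then show "\<exists>x\<in>A. y = ?f x" using f assms(1) \<open>y \<in> B\<close> by blast
  qed (use f in blast)
qed

text \<open>
  Each reduced quadruple belongs to exactly one \<open>k\<close> and each \<open>k\<close> to exactly one reduced
  quadruple. The index set stops at \<open>(p - 1) div 2\<close> so as to meet each pair \<open>{k, - k}\<close> once,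
  and starts at 2 because \<open>k = \<plusminus> 1\<close> never occurs.
\<close>
lemma card_reduced:
  fixes p :: nat
  assumes "prime p" and "odd p"
  shows "card {(a, b, c, d). reduced (int p) (int a) (int b) (int c) (int d)} = (p - 3) div 2"
    (is "card ?T = _")
proof -
  let ?K = "{2..(p - 1) div 2}"
  have P: "prime (int p)" using assms by simp
  have K: "k \<in> ?K \<longleftrightarrow> 1 < int k \<and> 2 * int k < int p" for k
    using \<open>odd p\<close> by (auto elim!: oddE)
  have lt: "0 < int c" "int c < int p" if "reduced (int p) (int a) (int b) (int c) (int d)" for a b c d
  proof -
    have "int a * 1 \<le> int a * int b" using that unfolding reduced_def by (intro mult_left_mono) auto
    moreover have "0 < int c * int d" using that unfolding reduced_def by auto
    ultimately show "0 < int c" "int c < int p"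
      using that unfolding reduced_def by linarith+
  qed
  have "card ?T = card ?K"
  proof (rule card_eq_of_unique_correspondence[where R = "\<lambda>s k. in_lattice_up_to_reflection p k s"])
    fix s assume "s \<in> ?T"
    then obtain a b c d where s: "s = (a, b, c, d)"
      and r: "reduced (int p) (int a) (int b) (int c) (int d)" by auto
    obtain k' where k': "1 < k'" "2 * k' \<le> int p"
      "in_lattice (int p) k' (int a) (int c) \<or> in_lattice (int p) (- k') (int a) (int c)"
      using lattice_index_exists[OF P r] by blast
    define k where "k = nat k'"
    have kk: "k' = int k" using k' by (simp add: k_def)
    have "2 * k \<noteq> p" using \<open>odd p\<close> by auto
    then have "k \<in> ?K \<and> in_lattice_up_to_reflection p k s"
      using k' unfolding K kk s in_lattice_up_to_reflection_def by auto
    moreover have "l = k" if "l \<in> ?K \<and> in_lattice_up_to_reflection p l s" for l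
      using lattice_index_unique[OF P lt[OF r], of "int l" "int k" "int a"] that calculation
      unfolding K s in_lattice_up_to_reflection_def by auto
    ultimately show "\<exists>!k. k \<in> ?K \<and> in_lattice_up_to_reflection p k s" by blast
  next
    fix k assume k: "k \<in> ?K"
    have "\<exists>a b c d. reduced (int p) a b c d \<and>
      (in_lattice (int p) (int k) a c \<or> in_lattice (int p) (- int k) a c)"
      using reduced_basis_exists[OF P] k[unfolded K] by blast
    then obtain a b c d where r: "reduced (int p) a b c d" and
      L: "in_lattice (int p) (int k) a c \<or> in_lattice (int p) (- int k) a c" by blast
    have "a = int (nat a)" "b = int (nat b)" "c = int (nat c)" "d = int (nat d)"
      using r unfolding reduced_def by auto
    then have ex: "(nat a, nat b, nat c, nat d) \<in> ?T \<and> in_lattice_up_to_reflection p k (nat a, nat b, nat c, nat d)"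
      using r L unfolding in_lattice_up_to_reflection_def by simp
    have "s = t" if st: "s \<in> ?T \<and> in_lattice_up_to_reflection p k s" "t \<in> ?T \<and> in_lattice_up_to_reflection p k t" for s t
    proof -
      obtain a b c d where s: "s = (a, b, c, d)"
        and r: "reduced (int p) (int a) (int b) (int c) (int d)" using st(1) by auto
      obtain a' b' c' d' where t: "t = (a', b', c', d')"
        and r': "reduced (int p) (int a') (int b') (int c') (int d')" using st(2) by auto
      have second: "in_lattice (int p) j (- int d) (int b)"
        if "in_lattice (int p) j (int a) (int c)" for j
        using second_basis_vector_in_lattice[OF P _ lt[OF r] that] r unfolding reduced_def by blast
      have second': "in_lattice (int p) j (- int d') (int b')"
        if "in_lattice (int p) j (int a') (int c')" for j
        using second_basis_vector_in_lattice[OF P _ lt[OF r'] that] r' unfolding reduced_def by blast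
      have "in_lattice (int p) (int k) (int a) (int c) \<or> in_lattice (int p) (- int k) (int a) (int c)"
        "in_lattice (int p) (int k) (int a') (int c') \<or> in_lattice (int p) (- int k) (int a') (int c')"
        using st unfolding s t in_lattice_up_to_reflection_def by auto
      then have "\<exists>j. in_lattice (int p) j (int a) (int c) \<and> in_lattice (int p) j (int a') (int c')"
        using no_reduced_basis_of_reflection[OF r r', of "int k"]
          no_reduced_basis_of_reflection[OF r' r, of "int k"] second second' by blast
      then show ?thesis
        using reduced_basis_unique[OF r r'] second second' unfolding s t by auto
    qed
    then show "\<exists>!s. s \<in> ?T \<and> in_lattice_up_to_reflection p k s" using ex by blast
  qed
  also have "card ?K = (p - 3) div 2" by simp
  finally show ?thesis .
qed

theorem theorem0p1:
  fixes p :: nat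
  assumes "prime p" and "odd p"
  shows "card {(a :: nat, b :: nat, c :: nat, d :: nat). p = a * b + c * d \<and> min a b > max c d}
      = (p + 1) div 2"
proof -
  let ?S = "{(a, b, c, d). p = a * b + c * d \<and> min a b > max c d}"
  let ?T = "{(a, b, c, d). reduced (int p) (int a) (int b) (int c) (int d)}"
  let ?D = "{(p, 1, 0, 0), (1, p, 0, 0)} :: (nat \<times> nat \<times> nat \<times> nat) set"
  have "p \<noteq> 2" using \<open>odd p\<close> by auto
  then have p3: "p \<ge> 3" using prime_ge_2_nat[OF assms(1)] by linarith
  have red: "reduced (int p) (int a) (int b) (int c) (int d) \<longleftrightarrow>
      p = a * b + c * d \<and> min a b > max c d \<and> 0 < c \<and> 0 < d" for a b c d
  proof -
    have "int p = int a * int b + int c * int d \<longleftrightarrow> p = a * b + c * d"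
      by (metis of_nat_add of_nat_eq_iff of_nat_mult)
    then show ?thesis unfolding reduced_def by auto
  qed
  have deg: "(a, b, c, d) \<in> ?D" if "p = a * b + c * d" "min a b > max c d" "c = 0 \<or> d = 0" for a b c d
  proof -
    have ab: "p = a * b" using that by auto
    then have "a = 1 \<or> b = 1" using assms(1) by (metis prime_product)
    then show ?thesis using ab that by auto
  qed
  have S: "?S = ?T \<union> ?D"
  proof (rule set_eqI)
    fix s :: "nat \<times> nat \<times> nat \<times> nat"
    obtain a b c d where s: "s = (a, b, c, d)" by (cases s) auto
    show "s \<in> ?S \<longleftrightarrow> s \<in> ?T \<union> ?D"
      using red[of a b c d] deg[of a b c d] p3 unfolding s by auto
  qed
  have fin: "finite ?T"
  proof (rule finite_subset)
    show "?T \<subseteq> {..p} \<times> {..p} \<times> {..p} \<times> {..p}"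
    proof
      fix s assume "s \<in> ?T"
      then obtain a b c d where s: "s = (a, b, c, d)"
        and h: "p = a * b + c * d" "c < a" "d < a" "c < b" "d < b" "0 < c" "0 < d"
        unfolding red by auto
      then have "a * 1 \<le> a * b" "1 * b \<le> a * b" by (intro mult_le_mono; simp)+
      then have "a \<le> p" "b \<le> p" using h(1) by linarith+
      then show "s \<in> {..p} \<times> {..p} \<times> {..p} \<times> {..p}" using h(2,3) s by simp
    qed
  qed simp
  have dis: "?T \<inter> ?D = {}" unfolding red by auto
  have "card ?S = card ?T + card ?D"
    unfolding S by (intro card_Un_disjoint fin dis) auto
  also have "card ?D = 2" using p3 by auto
  also have "card ?T + 2 = (p + 1) div 2"
    unfolding card_reduced[OF assms] using p3 \<open>odd p\<close> by (auto elim!: oddE)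
  finally show ?thesis .
qed

end
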